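(* Let $\mathcal{H}$ be a $d$-dimensional Hilbert space with orthonormal basis $\{|1\rangle,\dots,|d\rangle\}$. For $m,n\in\{1,\dots,d\}$ with $m\neq n$, let $|+_{mn}\rangle=\frac{1}{\sqrt2}(|m\rangle+|n\rangle)$ and $|-_{mn}\rangle=\frac{1}{\sqrt2}(|m\rangle-|n\rangle)$. Let $T$ be a set of $d-1$ pairs $(m,n)$, $m\neq n$, which form the edges of a connected graph with vertex set $\{1,\dots,d\}$. Then a trace-preserving quantum operation $\mathcal{E}$ on $\mathcal{H}$ is a unitary transform if and only if both of the following hold: (1) for all $m\neq n$, $\operatorname{tr}\left[\mathcal{E}(|m\rangle\langle m|)\,\mathcal{E}(|n\rangle\langle n|)\right]=0$; (2) for all $(m,n)\in T$, $\operatorname{tr}\left[\mathcal{E}(|+_{mn}\rangle\langle +_{mn}|)\,\mathcal{E}(|-_{mn}\rangle\langle -_{mn}|)\right]=0$.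
   Context: A quantum operation on a $d$-dimensional Hilbert space is a linear map $\mathcal{E}$ on $d\times d$ complex matrices admitting an operator-sum representation $\mathcal{E}(\rho)=\sum_i E_i\rho E_i^\dagger$ with finitely many $d\times d$ complex matrices $E_i$; it is trace-preserving if $\sum_i E_i^\dagger E_i=I$. $\mathcal{E}$ is a unitary transform if there is a unitary $d\times d$ matrix $U$ with $\mathcal{E}(\rho)=U\rho U^\dagger$ for all $\rho$. *)

theory Defs
  imports "HOL-Analysis.Analysis" "Graph_Theory.Graph_Theory"
begin

definition mat_dagger :: "complex^'n^'n \<Rightarrow> complex^'n^'n" where
  "mat_dagger A = (\<chi> i j. cnj (A $ j $ i))"

definition unitary_matrix :: "complex^'n^'n \<Rightarrow> bool" where
  "unitary_matrix U \<longleftrightarrow> mat_dagger U ** U = mat 1 \<and> U ** mat_dagger U = mat 1"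

text \<open>The inner product of the library on \<open>complex^'n\<close> is real-valued, so the Hermitian one is
  defined here, with the physicists' convention (conjugate-linear in the first argument).\<close>

definition braket :: "complex^'n \<Rightarrow> complex^'n \<Rightarrow> complex" where
  "braket u v = (\<Sum>i\<in>UNIV. cnj (u $ i) * v $ i)"

definition ketbra :: "complex^'n \<Rightarrow> complex^'n \<Rightarrow> complex^'n^'n" where
  "ketbra u v = (\<chi> i j. u $ i * cnj (v $ j))"

text \<open>A family of \<open>CARD('n)\<close> orthonormal vectors of \<open>complex^'n\<close> is automatically a basis.\<close>

definition orthonormal_basis :: "('n \<Rightarrow> complex^'n) \<Rightarrow> bool" where
  "orthonormal_basis b \<longleftrightarrow> (\<forall>m n. braket (b m) (b n) = (if m = n then 1 else 0))"

definition plus_state :: "('n \<Rightarrow> complex^'n) \<Rightarrow> 'n \<Rightarrow> 'n \<Rightarrow> complex^'n" where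
  "plus_state b m n = complex_of_real (1 / sqrt 2) *s (b m + b n)"

definition minus_state :: "('n \<Rightarrow> complex^'n) \<Rightarrow> 'n \<Rightarrow> 'n \<Rightarrow> complex^'n" where
  "minus_state b m n = complex_of_real (1 / sqrt 2) *s (b m - b n)"

text \<open>The matrices \<open>A 0, \<dots>, A (k - 1)\<close> are the operation elements; values of \<open>A\<close> beyond \<open>k\<close> are
  irrelevant. Linearity of \<open>\<E>\<close> follows from the representation.\<close>

definition operator_sum_rep ::
  "(complex^'n^'n \<Rightarrow> complex^'n^'n) \<Rightarrow> nat \<Rightarrow> (nat \<Rightarrow> complex^'n^'n) \<Rightarrow> bool" where
  "operator_sum_rep \<E> k A \<longleftrightarrow> (\<forall>\<rho>. \<E> \<rho> = (\<Sum>i<k. A i ** \<rho> ** mat_dagger (A i)))"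

definition quantum_operation :: "(complex^'n^'n \<Rightarrow> complex^'n^'n) \<Rightarrow> bool" where
  "quantum_operation \<E> \<longleftrightarrow> (\<exists>k A. operator_sum_rep \<E> k A)"

text \<open>The sum below does not depend on the chosen representation: it is the matrix \<open>M\<close> determined by
  \<open>trace (\<E> \<rho>) = trace (M ** \<rho>)\<close> for all \<open>\<rho>\<close>. Hence quantifying existentially over representations is
  the same as quantifying universally.\<close>

definition trace_preserving :: "(complex^'n^'n \<Rightarrow> complex^'n^'n) \<Rightarrow> bool" where
  "trace_preserving \<E> \<longleftrightarrow>
     (\<exists>k A. operator_sum_rep \<E> k A \<and> (\<Sum>i<k. mat_dagger (A i) ** A i) = mat 1)"

definition unitary_transform :: "(complex^'n^'n \<Rightarrow> complex^'n^'n) \<Rightarrow> bool" where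
  "unitary_transform \<E> \<longleftrightarrow>
     (\<exists>U. unitary_matrix U \<and> (\<forall>\<rho>. \<E> \<rho> = U ** \<rho> ** mat_dagger U))"

text \<open>Edges are given as ordered pairs; the library's \<open>connected\<close> for digraphs refers to the underlying
  undirected graph. The name is qualified because of topological connectedness.\<close>

definition connected_graph_on_all :: "('n \<times> 'n) set \<Rightarrow> bool" where
  "connected_graph_on_all T \<longleftrightarrow>
     Digraph_Component.connected (with_proj \<lparr>pverts = UNIV, parcs = T\<rparr>)"

end

theory Submission
  imports Defs
begin

text \<open>The trace of \<open>\<E>(|u\<rangle>\<langle>u|) \<E>(|v\<rangle>\<langle>v|)\<close> is \<open>\<Sum>\<^sub>i\<^sub>j |\<langle>A\<^sub>i u, A\<^sub>j v\<rangle>|\<^sup>2\<close>. Hence condition (1) says that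
  \<open>A\<^sub>i\<^sup>\<dagger> A\<^sub>j\<close> is diagonal in the basis \<open>b\<close>, and (2) then says that its diagonal entries agree along
  the edges of \<open>T\<close>, hence everywhere by connectedness. So \<open>A\<^sub>i\<^sup>\<dagger> A\<^sub>j = g\<^sub>i\<^sub>j I\<close> for scalars \<open>g\<^sub>i\<^sub>j\<close>. Some
  \<open>g\<^sub>i\<^sub>i\<close> is nonzero; normalizing that \<open>A\<^sub>i\<close> gives a unitary \<open>U\<close>, and
  \<open>A\<^sub>j = U U\<^sup>\<dagger> A\<^sub>j\<close> is a scalar multiple of \<open>U\<close> for every \<open>j\<close>.\<close>

section \<open>Adjoints and scalar matrices\<close>

lemma mat_dagger_mult: "mat_dagger (A ** B) = mat_dagger B ** mat_dagger A"
  by (simp add: mat_dagger_def matrix_matrix_mult_def vec_eq_iff mult.commute)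

lemma mat_dagger_mat: "mat_dagger (mat c) = mat (cnj c)"
  by (auto simp: mat_dagger_def mat_def vec_eq_iff)

lemma mat_mult_eq: "(mat c :: 'a::semiring_1^'n^'n) ** A = (\<chi> i j. c * A $ i $ j)"
  by (simp add: mat_def matrix_matrix_mult_def vec_eq_iff if_distrib[of "\<lambda>x. x * _"]
      cong: if_cong)

lemma mat_mult_mat: "(mat c :: 'a::semiring_1^'n^'n) ** mat d = mat (c * d)"
  unfolding mat_mult_eq by (simp add: mat_def vec_eq_iff)

text \<open>Scalar multiples of matrices are written as products with \<open>mat c\<close>;
  centrality lets these factors move through matrix products.\<close>

lemma mat_mult_commute: "(mat c :: 'a::comm_semiring_1^'n^'n) ** A = A ** mat c"
  unfolding mat_mult_eq
  by (simp add: mat_def matrix_matrix_mult_def vec_eq_iff if_distrib[of "\<lambda>x. _ * x"] mult.commute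
      cong: if_cong)

lemma sum_mat: "(\<Sum>i\<in>I. mat (f i)) = (mat (sum f I) :: 'a::semiring_1^'n^'n)"
  by (simp add: mat_def vec_eq_iff)

lemma mat_eq_iff: "(mat c :: 'a::semiring_1^'n^'n) = mat d \<longleftrightarrow> c = d"
  by (auto simp: mat_def vec_eq_iff split: if_splits)

section \<open>The Hermitian form and rank-one operators\<close>

lemma cnj_braket: "cnj (braket u v) = braket v u"
  by (simp add: braket_def mult.commute)

lemma braket_add_left: "braket (u + v) w = braket u w + braket v w"
  by (simp add: braket_def distrib_right sum.distrib)

lemma braket_diff_right: "braket u (v - w) = braket u v - braket u w"
  by (simp add: braket_def right_diff_distrib sum_subtractf)

lemma braket_scale_left: "braket (c *s u) v = cnj c * braket u v"
  by (simp add: braket_def sum_distrib_left mult.assoc)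

lemma braket_scale_right: "braket u (c *s v) = c * braket u v"
  by (simp add: braket_def sum_distrib_left mult.left_commute)

lemma braket_mult_left: "braket (A *v u) v = braket u (mat_dagger A *v v)"
proof -
  have "braket (A *v u) v = (\<Sum>i\<in>UNIV. \<Sum>j\<in>UNIV. cnj (A $ i $ j) * cnj (u $ j) * v $ i)"
    by (simp add: braket_def matrix_vector_mult_def sum_distrib_right)
  also have "\<dots> = (\<Sum>j\<in>UNIV. \<Sum>i\<in>UNIV. cnj (A $ i $ j) * cnj (u $ j) * v $ i)"
    by (rule sum.swap)
  also have "\<dots> = braket u (mat_dagger A *v v)"
    by (simp add: braket_def mat_dagger_def matrix_vector_mult_def sum_distrib_left mult_ac)
  finally show ?thesis .
qed

lemma braket_self: "braket u u = complex_of_real (\<Sum>i\<in>UNIV. (cmod (u $ i))\<^sup>2)"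
  by (simp add: braket_def complex_norm_square mult.commute del: of_real_power)

lemma mult_ketbra_mult: "A ** ketbra u v ** mat_dagger B = ketbra (A *v u) (B *v v)"
  by (simp add: ketbra_def mat_dagger_def matrix_matrix_mult_def matrix_vector_mult_def
      vec_eq_iff sum_distrib_left sum_distrib_right mult_ac)

lemma trace_ketbra_mult: "trace (ketbra u v ** ketbra x y) = braket v x * braket y u"
proof -
  have "trace (ketbra u v ** ketbra x y) =
      (\<Sum>i\<in>UNIV. \<Sum>k\<in>UNIV. u $ i * cnj (v $ k) * (x $ k * cnj (y $ i)))"
    by (simp add: trace_def ketbra_def matrix_matrix_mult_def)
  also have "\<dots> = (\<Sum>k\<in>UNIV. cnj (v $ k) * x $ k) * (\<Sum>i\<in>UNIV. cnj (y $ i) * u $ i)"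
    by (simp add: sum_product mult_ac)
  finally show ?thesis by (simp add: braket_def)
qed

section \<open>Traces of products of operator sums\<close>

lemma matrix_mult_sum_left: "(\<Sum>i\<in>I. f i) ** B = (\<Sum>i\<in>I. f i ** (B :: 'a::semiring_1^'n^'n))"
  by (auto simp: matrix_matrix_mult_def vec_eq_iff sum_distrib_right intro: sum.swap)

lemma matrix_mult_sum_right: "(B :: 'a::semiring_1^'n^'n) ** (\<Sum>i\<in>I. f i) = (\<Sum>i\<in>I. B ** f i)"
  by (auto simp: matrix_matrix_mult_def vec_eq_iff sum_distrib_left intro: sum.swap)

lemma trace_sum: "trace (\<Sum>i\<in>I. f i) = (\<Sum>i\<in>I. trace (f i :: 'a::comm_semiring_1^'n^'n))"
  by (simp add: trace_def) (rule sum.swap)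

text \<open>Each output \<open>\<E> (ketbra w w)\<close> is a sum of rank-one terms on the vectors
  \<open>A i *v w\<close>. The trace of a product of two such terms is a braket times its
  conjugate.\<close>

lemma trace_operator_sum_ketbra:
  assumes "operator_sum_rep \<E> k A"
  shows "trace (\<E> (ketbra u u) ** \<E> (ketbra v v)) =
    complex_of_real (\<Sum>i<k. \<Sum>j<k. (cmod (braket (A i *v u) (A j *v v)))\<^sup>2)"
proof -
  have "\<E> (ketbra w w) = (\<Sum>i<k. ketbra (A i *v w) (A i *v w))" for w
    using assms by (simp add: operator_sum_rep_def mult_ketbra_mult)
  then have "trace (\<E> (ketbra u u) ** \<E> (ketbra v v)) =
      (\<Sum>i<k. \<Sum>j<k. braket (A i *v u) (A j *v v) * cnj (braket (A i *v u) (A j *v v)))"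
    by (simp add: matrix_mult_sum_left matrix_mult_sum_right trace_sum trace_ketbra_mult cnj_braket) (rule sum.swap)
  then show ?thesis
    by (simp add: complex_norm_square del: of_real_power)
qed

text \<open>All summands are nonnegative reals, so they cannot cancel.\<close>

lemma trace_operator_sum_ketbra_eq_0_iff:
  assumes "operator_sum_rep \<E> k A"
  shows "trace (\<E> (ketbra u u) ** \<E> (ketbra v v)) = 0 \<longleftrightarrow>
    (\<forall>i<k. \<forall>j<k. braket (A i *v u) (A j *v v) = 0)"
proof -
  have "trace (\<E> (ketbra u u) ** \<E> (ketbra v v)) = 0 \<longleftrightarrow>
      (\<Sum>i<k. \<Sum>j<k. (cmod (braket (A i *v u) (A j *v v)))\<^sup>2) = 0"
    unfolding trace_operator_sum_ketbra[OF assms] by (rule of_real_eq_0_iff)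
  also have "\<dots> \<longleftrightarrow> (\<forall>i<k. \<forall>j<k. braket (A i *v u) (A j *v v) = 0)"
    by (auto simp: sum_nonneg_eq_0_iff sum_nonneg)
  finally show ?thesis .
qed

section \<open>Scalar matrices and connected graphs\<close>

text \<open>The matrix \<open>B\<close> with the basis vectors as columns is unitary and turns
  \<open>M\<close> into \<open>mat g\<close> by conjugation; conjugating back changes nothing, as
  \<open>mat g\<close> is central.\<close>

lemma orthonormal_basis_scalar_matrix:
  assumes b: "orthonormal_basis b"
    and M: "\<And>m n. braket (b m) (M *v b n) = (if m = n then g else 0)"
  shows "M = mat g"
proof -
  define B where "B = (\<chi> i j. b j $ i)"
  \<comment> \<open>With \<open>mat 1\<close> for \<open>X\<close> this makes orthonormality a
    statement about \<open>B\<close>; with \<open>M\<close> it rewrites the hypothesis.\<close>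
  have entry: "(mat_dagger B ** (X ** B)) $ m $ n = braket (b m) (X *v b n)" for X m n
    by (simp add: B_def mat_dagger_def matrix_matrix_mult_def braket_def matrix_vector_mult_def)
  have "(mat_dagger B ** B) $ m $ n = (if m = n then 1 else 0)" for m n
    using b entry[of "mat 1" m n] by (simp add: orthonormal_basis_def)
  then have "mat_dagger B ** B = mat 1"
    by (simp add: vec_eq_iff mat_def)
  then have id': "B ** mat_dagger B = mat 1"
    by (simp add: matrix_left_right_inverse)
  have "mat_dagger B ** (M ** B) = mat g"
    using M entry[of M] by (simp add: vec_eq_iff mat_def)
  then have "B ** (mat_dagger B ** (M ** B)) ** mat_dagger B = B ** mat g ** mat_dagger B"
    by simp
  then have "(B ** mat_dagger B) ** M ** (B ** mat_dagger B) = mat g ** (B ** mat_dagger B)"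
    by (simp add: matrix_mul_assoc mat_mult_commute[of g B])
  then show ?thesis
    by (simp add: id')
qed

lemma connected_graph_constant:
  assumes T: "connected_graph_on_all T"
    and edge: "\<And>m n. (m, n) \<in> T \<Longrightarrow> f m = f n"
  shows "f m = f n"
proof -
  let ?G = "with_proj \<lparr>pverts = UNIV, parcs = T\<rparr>"
  \<comment> \<open>\<open>connected\<close> is strong connectedness of the symmetrized graph, so
    the path may run through edges of \<open>T\<close> against their orientation.\<close>
  have "m \<rightarrow>\<^sup>*\<^bsub>with_proj (mk_symmetric ?G)\<^esub> n"
    using T unfolding connected_graph_on_all_def connected_def strongly_connected_def by simp
  then have "(m, n) \<in> rtrancl_on UNIV (parcs (mk_symmetric ?G))"
    by (simp add: reachable_def arcs_ends_def arc_to_ends_def)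
  then show ?thesis
  proof (induction rule: rtrancl_on_induct)
    case (step y z)
    then show ?case
      using edge by (auto simp: parcs_mk_symmetric)
  qed simp
qed

section \<open>From scalar products of the operation elements to a unitary\<close>

text \<open>Once each \<open>A j\<close> is \<open>c j\<close> times one unitary, trace preservation
  makes the squared moduli of the \<open>c j\<close> sum to 1, and the operator sum collapses to a
  single conjugation.\<close>

lemma unitary_transform_if_scalar_products:
  assumes rep: "operator_sum_rep \<E> k A"
    and tp: "(\<Sum>i<k. mat_dagger (A i) ** A i) = (mat 1 :: complex^'n^'n)"
    and scalar: "\<And>i j. i < k \<Longrightarrow> j < k \<Longrightarrow> mat_dagger (A i) ** A j = mat (g i j)"
  shows "unitary_transform \<E>"
proof -
  have sum_g: "(\<Sum>i<k. g i i) = 1"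
    using tp by (simp add: scalar sum_mat mat_eq_iff)
  have "\<exists>p<k. g p p \<noteq> 0"
  proof (rule ccontr)
    assume "\<not> ?thesis"
    then have "(\<Sum>i<k. g i i) = 0" by simp
    with sum_g show False by simp
  qed
  then obtain p where p: "p < k" "g p p \<noteq> 0" by blast
  \<comment> \<open>Any index serves: the corresponding diagonal entry of \<open>mat (g p p)\<close>
    is the squared norm of a column of \<open>A p\<close>, so \<open>g p p\<close> is real and
    nonnegative.\<close>
  obtain i0 :: 'n where True by blast
  define r where "r = (\<Sum>l\<in>UNIV. (cmod (column i0 (A p) $ l))\<^sup>2)"
  have g_r: "g p p = complex_of_real r"
  proof -
    have "g p p = (mat_dagger (A p) ** A p) $ i0 $ i0"
      using p by (simp add: scalar mat_def)
    also have "\<dots> = braket (column i0 (A p)) (column i0 (A p))"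
      by (simp add: matrix_matrix_mult_def mat_dagger_def braket_def column_def)
    finally show ?thesis
      by (simp only: braket_self r_def)
  qed
  \<comment> \<open>A real square root, so that taking the adjoint of \<open>U\<close> leaves the
    factor \<open>1 / s\<close> unchanged.\<close>
  define s where "s = complex_of_real (sqrt r)"
  have "r \<ge> 0" by (simp add: r_def sum_nonneg)
  then have s: "s * s = g p p" "cnj s = s"
    by (simp_all add: s_def g_r flip: of_real_mult)
  then have s0: "s \<noteq> 0" using p by auto
  define U where "U = mat (1 / s) ** A p"
  have dagger_U: "mat_dagger U = mat (1 / s) ** mat_dagger (A p)"
    by (simp add: U_def mat_dagger_mult mat_dagger_mat s
        mat_mult_commute[of _ "mat_dagger (A p)"])
  have U_A: "mat_dagger U ** A j = mat (g p j / s)" if "j < k" for j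
    using that p by (simp add: dagger_U scalar mat_mult_mat flip: matrix_mul_assoc)
  have "mat_dagger U ** U = mat (1 / s) ** (mat_dagger U ** A p)"
    by (simp add: U_def matrix_mul_assoc mat_mult_commute[of _ "mat_dagger U", unfolded U_def])
  also have "\<dots> = mat 1"
    using s0 p(1) by (simp add: U_A mat_mult_mat flip: s(1))
  finally have UU: "mat_dagger U ** U = mat 1" .
  then have UU': "U ** mat_dagger U = mat 1"
    by (simp add: matrix_left_right_inverse)
  define c where "c j = g p j / s" for j
  have A: "A j = mat (c j) ** U" if "j < k" for j
  proof -
    have "A j = U ** (mat_dagger U ** A j)"
      by (simp add: matrix_mul_assoc UU')
    then show ?thesis
      using that by (simp add: U_A c_def mat_mult_commute[of _ U])
  qed
  have conj_A: "A j ** \<rho> ** mat_dagger (A j) = mat (c j * cnj (c j)) ** (U ** \<rho> ** mat_dagger U)"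
    if "j < k" for j \<rho>
  proof -
    have "A j ** \<rho> ** mat_dagger (A j) = mat (c j) ** (U ** \<rho> ** mat_dagger U ** mat (cnj (c j)))"
      using that by (simp add: A mat_dagger_mult mat_dagger_mat matrix_mul_assoc)
    also have "U ** \<rho> ** mat_dagger U ** mat (cnj (c j)) =
        mat (cnj (c j)) ** (U ** \<rho> ** mat_dagger U)"
      by (rule mat_mult_commute[symmetric])
    finally show ?thesis
      by (simp add: matrix_mul_assoc mat_mult_mat)
  qed
  have "mat_dagger (A j) ** A j = mat (c j * cnj (c j))" if "j < k" for j
  proof -
    have "mat_dagger (A j) ** A j = mat_dagger U ** (mat (cnj (c j)) ** mat (c j)) ** U"
      using that by (simp add: A mat_dagger_mult mat_dagger_mat matrix_mul_assoc)
    also have "\<dots> = mat (cnj (c j) * c j) ** (mat_dagger U ** U)"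
      by (simp add: mat_mult_mat matrix_mul_assoc mat_mult_commute[of _ "mat_dagger U"])
    finally show ?thesis
      by (simp add: UU mult.commute)
  qed
  then have "(\<Sum>j<k. c j * cnj (c j)) = 1"
    using tp by (simp add: sum_mat mat_eq_iff)
  moreover have "\<E> \<rho> = mat (\<Sum>j<k. c j * cnj (c j)) ** (U ** \<rho> ** mat_dagger U)" for \<rho>
    using rep by (simp add: operator_sum_rep_def conj_A flip: sum_mat matrix_mult_sum_left)
  ultimately have "\<E> \<rho> = U ** \<rho> ** mat_dagger U" for \<rho>
    by simp
  then show ?thesis
    using UU UU' by (auto simp: unitary_transform_def unitary_matrix_def)
qed

section \<open>The trace conditions and the two directions of the equivalence\<close>

text \<open>A unitary preserves \<open>braket\<close>, and the representation by \<open>U\<close>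
  alone leaves a single term in the trace.\<close>

lemma trace_unitary_transform_ketbra:
  assumes "unitary_transform \<E>" and "braket u v = 0"
  shows "trace (\<E> (ketbra u u) ** \<E> (ketbra v v)) = 0"
proof -
  obtain U where U: "unitary_matrix U" and \<E>: "\<And>\<rho>. \<E> \<rho> = U ** \<rho> ** mat_dagger U"
    using assms(1) unfolding unitary_transform_def by blast
  have rep: "operator_sum_rep \<E> 1 (\<lambda>_. U)"
    by (simp add: operator_sum_rep_def \<E>)
  have "braket (U *v u) (U *v v) = 0"
    using U assms(2) by (simp add: braket_mult_left matrix_vector_mul_assoc unitary_matrix_def)
  then show ?thesis
    by (simp add: trace_operator_sum_ketbra_eq_0_iff[OF rep])
qed

text \<open>When the cross terms vanish, half the difference of two diagonal entries remains; this
  is how condition (2) compares them. Two matrices are allowed so as to cover all pairs of operation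
  elements.\<close>

lemma braket_plus_minus:
  "braket (M *v plus_state b m n) (N *v minus_state b m n) =
    (braket (M *v b m) (N *v b m) - braket (M *v b m) (N *v b n)
      + braket (M *v b n) (N *v b m) - braket (M *v b n) (N *v b n)) / 2"
proof -
  have half: "complex_of_real (1 / sqrt 2) * complex_of_real (1 / sqrt 2) = 1 / 2"
    by (simp flip: of_real_mult)
  have "braket (M *v plus_state b m n) (N *v minus_state b m n) =
      (complex_of_real (1 / sqrt 2) * complex_of_real (1 / sqrt 2)) *
      braket (M *v b m + M *v b n) (N *v b m - N *v b n)"
    unfolding plus_state_def minus_state_def
    by (simp only: vector_scalar_commute matrix_vector_right_distrib
        matrix_vector_mult_diff_distrib braket_scale_left braket_scale_right
        complex_cnj_complex_of_real mult.assoc)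
  then show ?thesis
    unfolding half by (simp add: braket_add_left braket_diff_right)
qed

theorem theorem1:
  fixes b :: "'n::finite \<Rightarrow> complex^'n"
    and T :: "('n \<times> 'n) set"
    and \<E> :: "complex^'n^'n \<Rightarrow> complex^'n^'n"
  assumes "orthonormal_basis b"
    and "\<forall>(m, n)\<in>T. m \<noteq> n"
    and "card T = CARD('n) - 1"
    and "connected_graph_on_all T"
    and "quantum_operation \<E>"
    and "trace_preserving \<E>"
  shows "unitary_transform \<E> \<longleftrightarrow>
    (\<forall>m n. m \<noteq> n \<longrightarrow>
       trace (\<E> (ketbra (b m) (b m)) ** \<E> (ketbra (b n) (b n))) = 0) \<and>
    (\<forall>(m, n)\<in>T.
       trace (\<E> (ketbra (plus_state b m n) (plus_state b m n)) **
              \<E> (ketbra (minus_state b m n) (minus_state b m n))) = 0)"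
    (is "_ \<longleftrightarrow> ?orth \<and> ?edges")
proof
  assume U: "unitary_transform \<E>"
  \<comment> \<open>Taking \<open>mat 1\<close> for both matrices reduces this to \<open>b m\<close>
    and \<open>b n\<close> being orthogonal and of equal norm.\<close>
  have "braket (plus_state b m n) (minus_state b m n) = 0" if "(m, n) \<in> T" for m n
    using assms(1,2) that braket_plus_minus[of "mat 1" b m n "mat 1"]
    by (auto simp: orthonormal_basis_def)
  with assms(1) show "?orth \<and> ?edges"
    by (auto simp: orthonormal_basis_def intro!: trace_unitary_transform_ketbra[OF U])
next
  assume cond: "?orth \<and> ?edges"
  obtain k A where rep: "operator_sum_rep \<E> k A"
    and tp: "(\<Sum>i<k. mat_dagger (A i) ** A i) = mat 1"
    using assms(6) by (auto simp: trace_preserving_def)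
  have orth: "braket (A i *v b m) (A j *v b n) = 0" if "m \<noteq> n" "i < k" "j < k" for m n i j
    using cond that by (simp add: trace_operator_sum_ketbra_eq_0_iff[OF rep])
  have edge: "braket (A i *v b m) (A j *v b m) = braket (A i *v b n) (A j *v b n)"
    if "(m, n) \<in> T" "i < k" "j < k" for m n i j
  proof -
    have "m \<noteq> n" using assms(2) that by auto
    moreover have "braket (A i *v plus_state b m n) (A j *v minus_state b m n) = 0"
      using cond that by (auto simp: trace_operator_sum_ketbra_eq_0_iff[OF rep])
    \<comment> \<open>The cross terms vanish by \<open>orth\<close>, so the two diagonal terms must
      agree.\<close>
    ultimately show ?thesis
      using that by (simp add: braket_plus_minus orth)
  qed
  \<comment> \<open>An arbitrary reference vertex; connectedness carries its value to all
    others.\<close>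
  obtain m0 :: 'n where True by blast
  define g where "g i j = braket (A i *v b m0) (A j *v b m0)" for i j
  have "mat_dagger (A i) ** A j = mat (g i j)" if ij: "i < k" "j < k" for i j
  proof (rule orthonormal_basis_scalar_matrix[OF assms(1)])
    fix m n
    have "braket (A i *v b m) (A j *v b m) = g i j" for m
      unfolding g_def
      by (rule connected_graph_constant[OF assms(4), where f = "\<lambda>m. braket (A i *v b m) (A j *v b m)"])
        (rule edge[OF _ ij])
    then show "braket (b m) ((mat_dagger (A i) ** A j) *v b n) = (if m = n then g i j else 0)"
      using orth[OF _ ij, of m n]
      by (auto simp: braket_mult_left simp flip: matrix_vector_mul_assoc)
  qed
  then show "unitary_transform \<E>"
    by (rule unitary_transform_if_scalar_products[OF rep tp])
qed

end
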